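(* Let $(U,\mathscr{C})$ be a covering approximation space, where $U=\{x_1,\dots,x_n\}$ and $\mathscr{C}=\{C_1,\dots,C_m\}$, let $X\subseteq U$, and let $\mathcal{X}_X$ be the characteristic function of $X$ (as a column vector). Then $$\mathcal{X}_{XH^{d}_{\mathscr{C}}(X)}=\left(\prod(\mathscr{C})\right)^{T}\bullet\prod(\mathscr{C})\bullet\mathcal{X}_X,\qquad \mathcal{X}_{XL^{d}_{\mathscr{C}}(X)}=\left(\left(\prod(\mathscr{C})\right)^{T}\bullet\prod(\mathscr{C})\right)\odot\mathcal{X}_X.$$
   Context: A covering approximation space $(U,\mathscr{C})$ consists of a finite nonempty set $U=\{x_1,\dots,x_n\}$ (distinct elements) and a covering $\mathscr{C}=\{C_1,\dots,C_m\}$ of $U$, i.e. a family of nonempty subsets of $U$ with union $U$. For $x\in U$ put $N(x)=\bigcap\{C_i\mid x\in C_i\in\mathscr{C}\}$. For $X\subseteq U$, writing $X^c=U\setminus X$, the sixth dual upper and lower approximations of $X$ are $XH^{d}_{\mathscr{C}}(X)=\bigcup\{N(x)\mid x\in U,\ N(x)\cap X\neq\emptyset\}$ and $XL^{d}_{\mathscr{C}}(X)=[XH^{d}_{\mathscr{C}}(X^{c})]^{c}$. The characteristic function of $X\subseteq U$ is the column vector $\mathcal{X}_X=[a_1\ \cdots\ a_n]^T$ with $a_i=1$ if $x_i\in X$ and $a_i=0$ otherwise. Matrix operations: for $0/1$ matrices $A=(a_{ik})_{n\times p}$ and $B=(b_{kj})_{p\times q}$, the Boolean product is $A\bullet B=(\bigvee_{k=1}^{p}(a_{ik}\cdot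 b_{kj}))_{n\times q}$, and $A\odot B=(\bigwedge_{k=1}^{p}(b_{kj}-a_{ik}+1))_{n\times q}$, where $\bigvee$ is maximum, $\bigwedge$ is minimum, and $+,-$ are ordinary integer operations. Unparenthesized products are evaluated from left to right. Let $M_{\mathscr{C}}=(a_{ij})_{n\times m}$ with $a_{ij}=1$ if $x_i\in C_j$ and $a_{ij}=0$ otherwise. The type-2 characteristic matrix of $\mathscr{C}$ is $\prod(\mathscr{C})=M_{\mathscr{C}}\odot M_{\mathscr{C}}^{T}=(c_{ij})_{n\times n}$, i.e. $c_{ij}=\bigwedge_{k=1}^{m}(a_{jk}-a_{ik}+1)$. *)

theory Defs
  imports "Jordan_Normal_Form.Matrix"
begin

definition covering_approximation_space :: "'a set \<Rightarrow> 'a set set \<Rightarrow> bool" where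
  "covering_approximation_space U \<C> \<longleftrightarrow>
     finite U \<and> U \<noteq> {} \<and> (\<forall>K\<in>\<C>. K \<noteq> {} \<and> K \<subseteq> U) \<and> \<Union>\<C> = U"

definition neighborhood :: "'a set set \<Rightarrow> 'a \<Rightarrow> 'a set" where
  "neighborhood \<C> x = \<Inter>{K. x \<in> K \<and> K \<in> \<C>}"

text \<open>The sixth dual upper and lower approximations.\<close>

definition XHd :: "'a set \<Rightarrow> 'a set set \<Rightarrow> 'a set \<Rightarrow> 'a set" where
  "XHd U \<C> X = \<Union>{neighborhood \<C> x | x. x \<in> U \<and> neighborhood \<C> x \<inter> X \<noteq> {}}"

definition XLd :: "'a set \<Rightarrow> 'a set set \<Rightarrow> 'a set \<Rightarrow> 'a set" where
  "XLd U \<C> X = U - XHd U \<C> (U - X)"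

text \<open>
  Enumerations \<open>x\<^sub>1, \<dots>, x\<^sub>n\<close> and \<open>C\<^sub>1, \<dots>, C\<^sub>m\<close> are lists, with indices
  shifted to start at 0. Entries 0/1 are integers and column vectors are matrices
  with one column, so that the two products below apply to vectors as well.
\<close>

definition char_fun :: "'a list \<Rightarrow> 'a set \<Rightarrow> int mat" where
  "char_fun xs X = mat (length xs) 1 (\<lambda>(i, j). if xs ! i \<in> X then 1 else 0)"

text \<open>
  Both products are meant for 0/1 matrices with \<open>dim_col A = dim_row B > 0\<close>.
  The second one takes the value 2 where row \<open>i\<close> of \<open>A\<close> is zero and column \<open>j\<close>
  of \<open>B\<close> has only entries 1; subtraction and addition are not truncated.
\<close>

definition bool_prod :: "int mat \<Rightarrow> int mat \<Rightarrow> int mat" (infixl "\<bullet>\<^sub>m" 70) where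
  "A \<bullet>\<^sub>m B = mat (dim_row A) (dim_col B)
     (\<lambda>(i, j). Max ((\<lambda>k. A $$ (i, k) * B $$ (k, j)) ` {..<dim_col A}))"

definition min_prod :: "int mat \<Rightarrow> int mat \<Rightarrow> int mat" (infixl "\<odot>\<^sub>m" 70) where
  "A \<odot>\<^sub>m B = mat (dim_row A) (dim_col B)
     (\<lambda>(i, j). Min ((\<lambda>k. B $$ (k, j) - A $$ (i, k) + 1) ` {..<dim_col A}))"

definition cover_mat :: "'a list \<Rightarrow> 'a set list \<Rightarrow> int mat" where
  "cover_mat xs Cs = mat (length xs) (length Cs) (\<lambda>(i, j). if xs ! i \<in> Cs ! j then 1 else 0)"

definition type2_char_mat :: "'a list \<Rightarrow> 'a set list \<Rightarrow> int mat" where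
  "type2_char_mat xs Cs = cover_mat xs Cs \<odot>\<^sub>m transpose_mat (cover_mat xs Cs)"

end

theory Submission
  imports Defs
begin

text \<open>
  A 0/1 matrix is the indicator of a relation. On such matrices the Boolean product is
  relational composition, and the minimum product is the universal condition
  \<open>\<forall>k. P i k \<longrightarrow> Q k j\<close>, provided every row of the first factor contains a 1. Hence the
  type-2 matrix is the indicator of \<open>x\<^sub>j \<in> N(x\<^sub>i)\<close>, and \<open>\<Prod>(\<C>)\<^sup>T \<bullet> \<Prod>(\<C>)\<close> is the indicator of
  ``\<open>x\<^sub>i\<close> and \<open>x\<^sub>j\<close> lie in a common neighborhood'', a reflexive relation on \<open>U\<close>.
\<close>

definition indicator_mat :: "nat \<Rightarrow> nat \<Rightarrow> (nat \<Rightarrow> nat \<Rightarrow> bool) \<Rightarrow> int mat" where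
  "indicator_mat n p P = mat n p (\<lambda>(i, j). of_bool (P i j))"

lemma indicator_mat_cong:
  assumes "\<And>i j. i < n \<Longrightarrow> j < p \<Longrightarrow> P i j \<longleftrightarrow> Q i j"
  shows "indicator_mat n p P = indicator_mat n p Q"
  unfolding indicator_mat_def by (rule eq_matI) (use assms in auto)

lemma transpose_indicator_mat:
  "transpose_mat (indicator_mat n p P) = indicator_mat p n (\<lambda>i j. P j i)"
  unfolding indicator_mat_def by (rule eq_matI) auto

lemma char_fun_eq_indicator_mat:
  "char_fun xs X = indicator_mat (length xs) 1 (\<lambda>i j. xs ! i \<in> X)"
  unfolding char_fun_def indicator_mat_def by (rule eq_matI) auto

lemma cover_mat_eq_indicator_mat:
  "cover_mat xs Cs = indicator_mat (length xs) (length Cs) (\<lambda>i j. xs ! i \<in> Cs ! j)"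
  unfolding cover_mat_def indicator_mat_def by (rule eq_matI) auto

text \<open>The value 1 is attained exactly when a witness exists; nonemptiness of \<open>A\<close>
  guarantees that otherwise 0 is attained.\<close>

lemma Max_of_bool:
  assumes "finite A" "A \<noteq> {}"
  shows "Max ((\<lambda>k. of_bool (P k) :: int) ` A) = of_bool (\<exists>k\<in>A. P k)"
  using assms by (intro Max_eqI) (auto simp: image_iff)

text \<open>On 0/1 entries, multiplication is conjunction and \<open>Max\<close> is the existential
  quantifier; \<open>p > 0\<close> keeps the maximum from ranging over an empty set.\<close>

lemma bool_prod_indicator_mat:
  assumes "p > 0"
  shows "indicator_mat n p P \<bullet>\<^sub>m indicator_mat p q Q
           = indicator_mat n q (\<lambda>i j. \<exists>k<p. P i k \<and> Q k j)"
proof (rule eq_matI)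
  fix i j
  assume "i < dim_row (indicator_mat n q (\<lambda>i j. \<exists>k<p. P i k \<and> Q k j))"
    and "j < dim_col (indicator_mat n q (\<lambda>i j. \<exists>k<p. P i k \<and> Q k j))"
  then have ij: "i < n" "j < q"
    by (simp_all add: indicator_mat_def)
  have "(\<lambda>k. indicator_mat n p P $$ (i, k) * indicator_mat p q Q $$ (k, j)) ` {..<p}
          = (\<lambda>k. of_bool (P i k \<and> Q k j)) ` {..<p}"
    using ij by (intro image_cong) (auto simp: indicator_mat_def)
  then have "(indicator_mat n p P \<bullet>\<^sub>m indicator_mat p q Q) $$ (i, j)
               = Max ((\<lambda>k. of_bool (P i k \<and> Q k j)) ` {..<p})"
    using ij by (simp add: bool_prod_def indicator_mat_def)
  also have "\<dots> = of_bool (\<exists>k\<in>{..<p}. P i k \<and> Q k j)"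
    using assms by (intro Max_of_bool) auto
  finally show "(indicator_mat n p P \<bullet>\<^sub>m indicator_mat p q Q) $$ (i, j)
                  = indicator_mat n q (\<lambda>i j. \<exists>k<p. P i k \<and> Q k j) $$ (i, j)"
    using ij by (auto simp: indicator_mat_def)
qed (simp_all add: bool_prod_def indicator_mat_def)

text \<open>A term is 0 if \<open>P k\<close> holds and \<open>Q k\<close> fails, 1 if both agree,
  and 2 if only \<open>Q k\<close> holds. An index with \<open>P k\<close> contributes at most 1,
  which rules out the minimum 2.\<close>

lemma Min_of_bool_diff:
  assumes "finite A" "\<exists>k\<in>A. P k"
  shows "Min ((\<lambda>k. of_bool (Q k) - of_bool (P k) + 1 :: int) ` A) = of_bool (\<forall>k\<in>A. P k \<longrightarrow> Q k)"
proof (rule Min_eqI)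
  show "of_bool (\<forall>k\<in>A. P k \<longrightarrow> Q k) \<in> (\<lambda>k. of_bool (Q k) - of_bool (P k) + 1 :: int) ` A"
  proof (cases "\<forall>k\<in>A. P k \<longrightarrow> Q k")
    case True
    then show ?thesis
      \<comment> \<open>The index with \<open>P k\<close> also satisfies \<open>Q k\<close>, so its
        term is 1.\<close>
      using assms(2) by (auto intro!: rev_image_eqI)
  next
    case False
    then obtain k where "k \<in> A" "P k" "\<not> Q k"
      by blast
    then show ?thesis
      \<comment> \<open>The violating index gives 0 - 1 + 1 = 0.\<close>
      by (auto intro!: rev_image_eqI[of k])
  qed
qed (use assms in auto)

lemma min_prod_indicator_mat:
  assumes "\<And>i. i < n \<Longrightarrow> \<exists>k<p. P i k"
  shows "indicator_mat n p P \<odot>\<^sub>m indicator_mat p q Q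
           = indicator_mat n q (\<lambda>i j. \<forall>k<p. P i k \<longrightarrow> Q k j)"
proof (rule eq_matI)
  fix i j
  assume "i < dim_row (indicator_mat n q (\<lambda>i j. \<forall>k<p. P i k \<longrightarrow> Q k j))"
    and "j < dim_col (indicator_mat n q (\<lambda>i j. \<forall>k<p. P i k \<longrightarrow> Q k j))"
  then have ij: "i < n" "j < q"
    by (simp_all add: indicator_mat_def)
  have "(\<lambda>k. indicator_mat p q Q $$ (k, j) - indicator_mat n p P $$ (i, k) + 1) ` {..<p}
          = (\<lambda>k. of_bool (Q k j) - of_bool (P i k) + 1) ` {..<p}"
    using ij by (intro image_cong) (auto simp: indicator_mat_def)
  then have "(indicator_mat n p P \<odot>\<^sub>m indicator_mat p q Q) $$ (i, j)
               = Min ((\<lambda>k. of_bool (Q k j) - of_bool (P i k) + 1) ` {..<p})"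
    using ij by (simp add: min_prod_def indicator_mat_def)
  also have "\<dots> = of_bool (\<forall>k\<in>{..<p}. P i k \<longrightarrow> Q k j)"
    using assms[OF ij(1)] by (intro Min_of_bool_diff) auto
  finally show "(indicator_mat n p P \<odot>\<^sub>m indicator_mat p q Q) $$ (i, j)
                  = indicator_mat n q (\<lambda>i j. \<forall>k<p. P i k \<longrightarrow> Q k j) $$ (i, j)"
    using ij by (auto simp: indicator_mat_def)
qed (simp_all add: min_prod_def indicator_mat_def)

text \<open>This is unconditional: if no member of the family contains \<open>x\<close>, the
  intersection is \<open>UNIV\<close>.\<close>

lemma mem_neighborhood_self: "x \<in> neighborhood \<C> x"
  by (auto simp: neighborhood_def)

lemma neighborhood_subset:
  assumes "covering_approximation_space U \<C>" "x \<in> U"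
  shows "neighborhood \<C> x \<subseteq> U"
  using assms unfolding covering_approximation_space_def neighborhood_def by blast

text \<open>The universal condition says that every covering member containing \<open>xs ! i\<close>
  contains \<open>xs ! j\<close>. The covering hypothesis puts a 1 in each row of
  \<open>cover_mat xs Cs\<close>, as the minimum product requires.\<close>

lemma type2_char_mat_eq_indicator_mat:
  assumes "set xs \<subseteq> \<Union>(set Cs)"
  shows "type2_char_mat xs Cs
           = indicator_mat (length xs) (length xs) (\<lambda>i j. xs ! j \<in> neighborhood (set Cs) (xs ! i))"
proof -
  have "\<exists>k<length Cs. xs ! i \<in> Cs ! k" if "i < length xs" for i
    using assms nth_mem[OF that] by (fastforce simp: in_set_conv_nth)
  then have "type2_char_mat xs Cs = indicator_mat (length xs) (length xs)
      (\<lambda>i j. \<forall>k<length Cs. xs ! i \<in> Cs ! k \<longrightarrow> xs ! j \<in> Cs ! k)"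
    unfolding type2_char_mat_def cover_mat_eq_indicator_mat transpose_indicator_mat
    by (rule min_prod_indicator_mat)
  also have "\<dots> = indicator_mat (length xs) (length xs)
      (\<lambda>i j. xs ! j \<in> neighborhood (set Cs) (xs ! i))"
    by (rule indicator_mat_cong) (auto simp: neighborhood_def in_set_conv_nth)
  finally show ?thesis .
qed

theorem theorem3p11:
  fixes U :: "'a set" and \<C> :: "'a set set" and X :: "'a set"
    and xs :: "'a list" and Cs :: "'a set list"
  assumes "covering_approximation_space U \<C>"
    and "distinct xs" and "set xs = U"
    and "set Cs = \<C>"
    and "X \<subseteq> U"
  shows "char_fun xs (XHd U \<C> X) =
           transpose_mat (type2_char_mat xs Cs) \<bullet>\<^sub>m type2_char_mat xs Cs \<bullet>\<^sub>m char_fun xs X \<and>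
         char_fun xs (XLd U \<C> X) =
           (transpose_mat (type2_char_mat xs Cs) \<bullet>\<^sub>m type2_char_mat xs Cs) \<odot>\<^sub>m char_fun xs X"
proof -
  let ?n = "length xs"
  let ?N = "neighborhood \<C>"
  \<comment> \<open>The index \<open>k\<close> is the centre of the common neighborhood: because of
    the transpose, the composition sums over the row index of both factors.\<close>
  let ?R = "\<lambda>i j. \<exists>k<?n. xs ! i \<in> ?N (xs ! k) \<and> xs ! j \<in> ?N (xs ! k)"
  have n: "?n > 0"
    using assms unfolding covering_approximation_space_def by auto
  have N_sub: "?N (xs ! k) \<subseteq> set xs" if "k < ?n" for k
    using neighborhood_subset[OF assms(1)] assms(3) nth_mem[OF that] by blast
  have "set xs \<subseteq> \<Union>(set Cs)"
    using assms unfolding covering_approximation_space_def by blast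
  then have product: "transpose_mat (type2_char_mat xs Cs) \<bullet>\<^sub>m type2_char_mat xs Cs
      = indicator_mat ?n ?n ?R"
    using n by (simp add: type2_char_mat_eq_indicator_mat transpose_indicator_mat
        bool_prod_indicator_mat assms(4))
  \<comment> \<open>Both the column and the centre are taken to be \<open>i\<close>; so every row of
    the product contains a 1.\<close>
  have R_refl: "\<exists>j<?n. ?R i j" if "i < ?n" for i
    by (intro exI[of _ i] conjI that mem_neighborhood_self)
  have R_min_prod: "indicator_mat ?n ?n ?R \<odot>\<^sub>m indicator_mat ?n q Q
      = indicator_mat ?n q (\<lambda>i j. \<forall>k<?n. ?R i k \<longrightarrow> Q k j)" for q Q
    by (rule min_prod_indicator_mat) (rule R_refl)
  \<comment> \<open>\<open>Y\<close> is kept arbitrary, since the upper approximation is needed for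
    \<open>X\<close> and for \<open>U - X\<close>.\<close>
  have mem_XHd: "y \<in> XHd U \<C> Y \<longleftrightarrow>
      (\<exists>j<?n. (\<exists>k<?n. y \<in> ?N (xs ! k) \<and> xs ! j \<in> ?N (xs ! k)) \<and> xs ! j \<in> Y)"
    for y Y
  proof
    assume "y \<in> XHd U \<C> Y"
    then obtain x z where xz: "x \<in> U" "y \<in> ?N x" "z \<in> ?N x" "z \<in> Y"
      unfolding XHd_def by auto
    then obtain k where k: "k < ?n" "x = xs ! k"
      using assms(3) by (metis in_set_conv_nth)
    \<comment> \<open>The point \<open>z\<close> has an index because it lies in a neighborhood, and
      these stay inside \<open>U\<close>.\<close>
    then obtain j where "j < ?n" "z = xs ! j"
      using N_sub xz(3) by (metis in_set_conv_nth subsetD)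
    with xz k show "\<exists>j<?n. (\<exists>k<?n. y \<in> ?N (xs ! k) \<and> xs ! j \<in> ?N (xs ! k)) \<and> xs ! j \<in> Y"
      by blast
  next
    assume "\<exists>j<?n. (\<exists>k<?n. y \<in> ?N (xs ! k) \<and> xs ! j \<in> ?N (xs ! k)) \<and> xs ! j \<in> Y"
    then obtain j k where "xs ! j \<in> Y" "k < ?n" "y \<in> ?N (xs ! k)" "xs ! j \<in> ?N (xs ! k)"
      by blast
    moreover from \<open>k < ?n\<close> have "xs ! k \<in> U"
      using assms(3) by auto
    ultimately show "y \<in> XHd U \<C> Y"
      unfolding XHd_def by blast
  qed
  have "char_fun xs (XHd U \<C> X) = indicator_mat ?n ?n ?R \<bullet>\<^sub>m char_fun xs X"
    unfolding char_fun_eq_indicator_mat bool_prod_indicator_mat[OF n]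
    by (rule indicator_mat_cong) (rule mem_XHd)
  moreover have "char_fun xs (XLd U \<C> X) = indicator_mat ?n ?n ?R \<odot>\<^sub>m char_fun xs X"
    unfolding char_fun_eq_indicator_mat R_min_prod
  proof (rule indicator_mat_cong)
    fix i
    assume "i < ?n"
    then have "xs ! i \<in> U"
      using assms(3) by auto
    moreover have "xs ! j \<in> U" if "j < ?n" for j
      using assms(3) that by auto
    \<comment> \<open>Negating \<open>mem_XHd\<close> for \<open>U - X\<close> turns the existential
      into this universal statement; membership of both points in \<open>U\<close> resolves the two
      complements.\<close>
    ultimately show "xs ! i \<in> XLd U \<C> X \<longleftrightarrow> (\<forall>j<?n. ?R i j \<longrightarrow> xs ! j \<in> X)"
      unfolding XLd_def Diff_iff mem_XHd by auto
  qed
  ultimately show ?thesis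
    unfolding product by (rule conjI)
qed

end
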